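(* Let $d\ge1$, let $SPP$ be the set of symmetric positive definite symplectic matrices in $\mathbb{R}^{2d\times 2d}$, and let $\mathcal{L}_{4}^{2}=\{LL^{T} : L\in\mathcal{L}_{4}\}$. Then $SPP=\mathcal{L}_{4}^{2}$. Thus any positive definite symplectic matrix can be represented as the product of a matrix which can be factored into no more than $4$ unit triangular symplectic matrices and the transpose of that matrix.
   Context: Let $I=I_d$ and $J=\begin{bmatrix} 0 & I_{d} \\ -I_{d} & 0 \end{bmatrix}$. A real $2d\times 2d$ matrix $H$ is symplectic if $H^{T}JH=J$. The unit triangular symplectic matrices are those of the form $\begin{bmatrix} I & S \\ 0 & I\end{bmatrix}$ (upper) or $\begin{bmatrix} I & 0 \\ S & I\end{bmatrix}$ (lower) with $S\in\mathbb{R}^{d\times d}$ symmetric. $\mathcal{L}_{4}$ is the set of all products $\begin{bmatrix} I & 0 \\ S_{4} & I \end{bmatrix}\begin{bmatrix} I & S_{3} \\ 0 & I \end{bmatrix}\begin{bmatrix} I & 0 \\ S_{2} & I \end{bmatrix}\begin{bmatrix} I & S_{1} \\ 0 & I \end{bmatrix}$ with $S_1,\dots,S_4\in\mathbb{R}^{d\times d}$ symmetric. "Positive definite" means symmetric positive definite. *)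

theory Defs
  imports "HOL-Analysis.Analysis"
begin

(* A 2d x 2d matrix is indexed by the disjoint sum 'd + 'd: Inl indexes the first d
   rows/columns, Inr the last d. Since types are nonempty, d = CARD('d) >= 1. *)

definition block_matrix ::
  "'a^'d^'d \<Rightarrow> 'a^'d^'d \<Rightarrow> 'a^'d^'d \<Rightarrow> 'a^'d^'d \<Rightarrow> 'a^('d::finite + 'd)^('d + 'd)" where
  "block_matrix A B C D = (\<chi> i j.
     case i of
       Inl k \<Rightarrow> (case j of Inl l \<Rightarrow> A $ k $ l | Inr l \<Rightarrow> B $ k $ l)
     | Inr k \<Rightarrow> (case j of Inl l \<Rightarrow> C $ k $ l | Inr l \<Rightarrow> D $ k $ l))"

definition symplectic_J :: "real^('d::finite + 'd)^('d + 'd)" where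
  "symplectic_J = block_matrix 0 (mat 1) (- mat 1) 0"

definition symplectic :: "real^('d::finite + 'd)^('d + 'd) \<Rightarrow> bool" where
  "symplectic H \<longleftrightarrow> transpose H ** symplectic_J ** H = symplectic_J"

definition symmetric_matrix :: "real^'n^'n \<Rightarrow> bool" where
  "symmetric_matrix S \<longleftrightarrow> transpose S = S"

definition positive_definite :: "real^'n^'n \<Rightarrow> bool" where
  "positive_definite H \<longleftrightarrow> symmetric_matrix H \<and> (\<forall>x. x \<noteq> 0 \<longrightarrow> x \<bullet> (H *v x) > 0)"

definition unit_upper :: "real^'d^'d \<Rightarrow> real^('d::finite + 'd)^('d + 'd)" where
  "unit_upper S = block_matrix (mat 1) S 0 (mat 1)"

definition unit_lower :: "real^'d^'d \<Rightarrow> real^('d::finite + 'd)^('d + 'd)" where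
  "unit_lower S = block_matrix (mat 1) 0 S (mat 1)"

definition unit_triangular_symplectic :: "(real^('d::finite + 'd)^('d + 'd)) set" where
  "unit_triangular_symplectic =
     {unit_upper S | S. symmetric_matrix S} \<union> {unit_lower S | S. symmetric_matrix S}"

definition L4 :: "(real^('d::finite + 'd)^('d + 'd)) set" where
  "L4 = {unit_lower S4 ** unit_upper S3 ** unit_lower S2 ** unit_upper S1 | S1 S2 S3 S4.
     symmetric_matrix S1 \<and> symmetric_matrix S2 \<and> symmetric_matrix S3 \<and> symmetric_matrix S4}"

definition L4_squared :: "(real^('d::finite + 'd)^('d + 'd)) set" where
  "L4_squared = {L ** transpose L | L. L \<in> L4}"

definition SPP :: "(real^('d::finite + 'd)^('d + 'd)) set" where
  "SPP = {H. positive_definite H \<and> symplectic H}"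

end

theory Submission
  imports Defs
begin

text \<open>If L is in \<open>L4\<close>, then L and its transpose are both products of symplectic
  matrices, so L L^T is symplectic; it is positive definite because a symplectic matrix has trivial
  kernel (\<open>L4_squared_subset_SPP\<close>).

  Conversely, let H be positive definite and symplectic with blocks A, B, C, D. The block A is
  positive definite, so A = X^2 with X symmetric and invertible
  (\<open>positive_definite_square_root\<close>). Symplecticity makes T = C A^-1 symmetric and
  forces D = T B + A^-1. These relations say exactly that H = L L^T, where L is block lower
  triangular with rows (X, 0) and (T X, X^-1). Three unit triangular factors already produce the
  diagonal blocks X and X^-1, and a fourth corrects the lower left block, so L is in
  \<open>L4\<close> (\<open>SPP_subset_L4_squared\<close>).

  The square root comes from Banach's fixed point theorem on self-adjoint operators
  (\<open>fixed_point_selfadjoint\<close>).\<close>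

section \<open>Matrix algebra and block matrices\<close>

lemma matrix_minus_mult_left: "(- A) ** B = - (A ** B)"
  for A :: "real^'m^'n" and B :: "real^'k^'m"
  by (simp add: matrix_matrix_mult_def vec_eq_iff sum_negf)

lemma matrix_minus_mult_right: "A ** (- B) = - (A ** B)"
  for A :: "real^'m^'n" and B :: "real^'k^'m"
  by (simp add: matrix_matrix_mult_def vec_eq_iff sum_negf)

lemma matrix_zero_mult [simp]:
  fixes A :: "real^'m^'n"
  shows "A ** (0 :: real^'k^'m) = 0" "(0 :: real^'n^'k) ** A = 0"
  by (simp_all add: matrix_matrix_mult_def vec_eq_iff)

lemma matrix_diff_mult_left: "(A - B) ** C = A ** C - B ** C"
  for A :: "real^'m^'n" and C :: "real^'k^'m"
  by (simp add: matrix_matrix_mult_def vec_eq_iff sum_subtractf algebra_simps)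

lemma matrix_diff_mult_right: "A ** (B - C) = A ** B - A ** C"
  for A :: "real^'m^'n" and C :: "real^'k^'m"
  by (simp add: matrix_matrix_mult_def vec_eq_iff sum_subtractf algebra_simps)

lemma matrix_add_mult_left: "(A + B) ** C = A ** C + B ** C"
  for A :: "real^'m^'n" and C :: "real^'k^'m"
  by (simp add: matrix_matrix_mult_def vec_eq_iff sum.distrib algebra_simps)

lemmas matrix_ring_simps = matrix_add_ldistrib matrix_add_mult_left matrix_diff_mult_left
  matrix_diff_mult_right matrix_minus_mult_left matrix_minus_mult_right

lemma transpose_diff: "transpose (A - B) = transpose A - transpose B"
  for A :: "real^'m^'n"
  by (simp add: transpose_def vec_eq_iff)

lemma transpose_add: "transpose (A + B) = transpose A + transpose B"
  for A :: "real^'m^'n"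
  by (simp add: transpose_def vec_eq_iff)

lemma transpose_uminus: "transpose (- A) = - transpose A"
  for A :: "real^'m^'n"
  by (simp add: transpose_def vec_eq_iff)

lemma transpose_zero: "transpose (0 :: real^'m^'n) = 0"
  by (simp add: transpose_def vec_eq_iff)

lemma block_matrix_nth [simp]:
  "block_matrix A B C D $ Inl i $ Inl j = A $ i $ j"
  "block_matrix A B C D $ Inl i $ Inr j = B $ i $ j"
  "block_matrix A B C D $ Inr i $ Inl j = C $ i $ j"
  "block_matrix A B C D $ Inr i $ Inr j = D $ i $ j"
  by (simp_all add: block_matrix_def)

lemma block_matrix_eqI:
  fixes H K :: "'a^('d::finite + 'd)^('d + 'd)"
  assumes "\<And>i j. H $ Inl i $ Inl j = K $ Inl i $ Inl j"
    and "\<And>i j. H $ Inl i $ Inr j = K $ Inl i $ Inr j"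
    and "\<And>i j. H $ Inr i $ Inl j = K $ Inr i $ Inl j"
    and "\<And>i j. H $ Inr i $ Inr j = K $ Inr i $ Inr j"
  shows "H = K"
proof -
  have "H $ i $ j = K $ i $ j" for i j
    using assms by (cases i; cases j) auto
  then show ?thesis by (simp add: vec_eq_iff)
qed

lemma block_matrix_eq_iff:
  "block_matrix A B C D = block_matrix A' B' C' D' \<longleftrightarrow> A = A' \<and> B = B' \<and> C = C' \<and> D = D'"
  by (metis (no_types, lifting) block_matrix_nth vec_eq_iff)

lemma block_matrix_cases:
  fixes H :: "'a^('d::finite + 'd)^('d + 'd)"
  obtains A B C D where "H = block_matrix A B C D"
proof
  show "H = block_matrix (\<chi> i j. H $ Inl i $ Inl j) (\<chi> i j. H $ Inl i $ Inr j)
      (\<chi> i j. H $ Inr i $ Inl j) (\<chi> i j. H $ Inr i $ Inr j)"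
    by (rule block_matrix_eqI) auto
qed

lemma transpose_block_matrix:
  "transpose (block_matrix A B C D) =
    block_matrix (transpose A) (transpose C) (transpose B) (transpose D)"
  by (rule block_matrix_eqI) (auto simp: transpose_def)

lemma sum_UNIV_sum_type:
  fixes f :: "'a::finite + 'b::finite \<Rightarrow> 'c::comm_monoid_add"
  shows "sum f UNIV = (\<Sum>i\<in>UNIV. f (Inl i)) + (\<Sum>i\<in>UNIV. f (Inr i))"
  unfolding UNIV_Plus_UNIV[symmetric] by (subst sum.Plus) auto

lemma block_matrix_mult:
  fixes A B C D :: "'a::semiring_1^'d::finite^'d"
  shows "block_matrix A B C D ** block_matrix A' B' C' D' =
    block_matrix (A ** A' + B ** C') (A ** B' + B ** D') (C ** A' + D ** C') (C ** B' + D ** D')"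
  by (rule block_matrix_eqI) (auto simp: matrix_matrix_mult_def sum_UNIV_sum_type)

lemma mat_1_block_matrix: "mat 1 = block_matrix (mat 1) 0 0 (mat 1)"
  by (rule block_matrix_eqI) (auto simp: mat_def)

lemma symmetric_matrix_block:
  "symmetric_matrix (block_matrix A B C D) \<longleftrightarrow>
    symmetric_matrix A \<and> symmetric_matrix D \<and> C = transpose B"
  by (auto simp: symmetric_matrix_def transpose_block_matrix block_matrix_eq_iff)

text \<open>Padding x with zeros in the last d coordinates turns the quadratic form of the whole
  matrix into that of A.\<close>

lemma positive_definite_block_upper_left:
  fixes A :: "real^'d::finite^'d"
  assumes "positive_definite (block_matrix A B C D)"
  shows "positive_definite A"
  unfolding positive_definite_def
proof (intro conjI allI impI)
  show "symmetric_matrix A"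
    using assms by (simp add: positive_definite_def symmetric_matrix_block)
  fix x :: "real^'d" assume "x \<noteq> 0"
  define y :: "real^('d + 'd)" where "y = (\<chi> i. case i of Inl k \<Rightarrow> x $ k | Inr k \<Rightarrow> 0)"
  have y_nth: "y $ Inl k = x $ k" "y $ Inr k = 0" for k
    by (simp_all add: y_def)
  have "y \<noteq> 0"
    using \<open>x \<noteq> 0\<close> y_nth by (metis vec_eq_iff zero_index)
  then have "y \<bullet> (block_matrix A B C D *v y) > 0"
    using assms by (simp add: positive_definite_def)
  then show "x \<bullet> (A *v x) > 0"
    by (simp add: inner_vec_def matrix_vector_mult_def sum_UNIV_sum_type y_nth)
qed

section \<open>Square roots of positive definite matrices\<close>

text \<open>The map \<open>f\<close> sends the ball of radius r into itself, since (r + r^2) / 2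
  \<le> r, and contracts it with factor r. Bounded linear maps carry the operator norm, which is
  submultiplicative and can be bounded pointwise.\<close>

lemma fixed_point_selfadjoint:
  fixes E :: "'a::euclidean_space \<Rightarrow>\<^sub>L 'a"
  assumes E: "norm E \<le> r" and r: "r < 1"
    and sym: "\<And>x y. x \<bullet> E y = E x \<bullet> y"
  obtains Z :: "'a \<Rightarrow>\<^sub>L 'a"
  where "2 *\<^sub>R Z = E + (Z o\<^sub>L Z)" "\<And>x y. x \<bullet> Z y = Z x \<bullet> y"
proof -
  define f where "f = (\<lambda>Z. (1/2) *\<^sub>R (E + (Z o\<^sub>L Z)))"
  \<comment> \<open>Self-adjointness is a closed condition preserved by \<open>f\<close>, so
    building it into the domain makes the fixed point self-adjoint.\<close>
  define S where "S = {Z :: 'a \<Rightarrow>\<^sub>L 'a. norm Z \<le> r} \<inter> {Z :: 'a \<Rightarrow>\<^sub>L 'a. \<forall>x y. x \<bullet> Z y = Z x \<bullet> y}"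
  have r0: "0 \<le> r" using E norm_ge_zero[of E] by linarith
  have "closed S"
    unfolding S_def by (intro closed_Int closed_Collect_le closed_Collect_all closed_Collect_eq continuous_intros)
  then have "complete S" by (simp add: complete_eq_closed)
  moreover have "0 \<in> S" using r0 by (simp add: S_def)
  then have "S \<noteq> {}" by blast
  moreover have "f ` S \<subseteq> S"
  proof
    fix W assume "W \<in> f ` S"
    then obtain Z where Z: "Z \<in> S" "W = f Z" by auto
    have "norm (Z o\<^sub>L Z) \<le> norm Z * norm Z" by (rule norm_blinfun_compose)
    also have "\<dots> \<le> r * 1" using Z r r0 by (intro mult_mono) (auto simp: S_def)
    finally have "norm (E + (Z o\<^sub>L Z)) \<le> 2 * r" using E norm_triangle_ineq[of E "Z o\<^sub>L Z"] by linarith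
    then show "W \<in> S"
      using Z sym by (auto simp: S_def f_def blinfun.add_left blinfun.scaleR_left inner_add_left inner_add_right)
  qed
  moreover have "dist (f Z) (f W) \<le> r * dist Z W" if "Z \<in> S" "W \<in> S" for Z W
  proof -
    \<comment> \<open>Z^2 - W^2 = Z (Z - W) + (Z - W) W holds without commutativity.\<close>
    have eq: "f Z - f W = (1/2) *\<^sub>R ((Z o\<^sub>L (Z - W)) + ((Z - W) o\<^sub>L W))"
      by (rule blinfun_eqI) (simp add: f_def blinfun.add_left blinfun.diff_left blinfun.diff_right
          blinfun.scaleR_left scaleR_diff_right[symmetric])
    have "norm (Z o\<^sub>L (Z - W)) \<le> r * norm (Z - W)"
      using that by (intro order_trans[OF norm_blinfun_compose] mult_right_mono) (auto simp: S_def)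
    moreover have "norm ((Z - W) o\<^sub>L W) \<le> norm (Z - W) * r"
      using that by (intro order_trans[OF norm_blinfun_compose] mult_left_mono) (auto simp: S_def)
    ultimately show ?thesis
      using norm_triangle_ineq[of "Z o\<^sub>L (Z - W)" "(Z - W) o\<^sub>L W"]
      unfolding dist_norm eq by (simp add: mult.commute)
  qed
  ultimately have "\<exists>!Z. Z \<in> S \<and> f Z = Z"
    using r r0 by (intro Banach_fix) auto
  then obtain Z where Z: "Z \<in> S" "f Z = Z" by auto
  have "2 *\<^sub>R f Z = E + (Z o\<^sub>L Z)" by (simp add: f_def)
  with Z show thesis
    using that[of Z] by (simp add: S_def)
qed

text \<open>The constant is the minimum of the quadratic form on the compact unit sphere;
  homogeneity extends the bound to all vectors.\<close>

lemma positive_definite_coercive: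
  fixes A :: "real^'n^'n"
  assumes "positive_definite A"
  obtains m where "0 < m" "\<And>x. m * (norm x)\<^sup>2 \<le> x \<bullet> (A *v x)"
proof -
  have cont: "continuous_on (sphere 0 1) (\<lambda>x. x \<bullet> (A *v x))"
    by (intro continuous_intros linear_continuous_on matrix_vector_mul_bounded_linear)
  have ne: "sphere (0::real^'n) 1 \<noteq> {}" by auto
  obtain u where u: "u \<in> sphere 0 1" "\<And>y. y \<in> sphere 0 1 \<Longrightarrow> u \<bullet> (A *v u) \<le> y \<bullet> (A *v y)"
    using continuous_attains_inf[OF compact_sphere ne cont] by blast
  show thesis
  proof
    show "0 < u \<bullet> (A *v u)"
      using u(1) assms unfolding positive_definite_def
      by (metis mem_sphere_0 norm_zero zero_neq_one)
    fix x
    show "u \<bullet> (A *v u) * (norm x)\<^sup>2 \<le> x \<bullet> (A *v x)"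
    proof (cases "x = 0")
      case False
      let ?y = "(1 / norm x) *\<^sub>R x"
      have "u \<bullet> (A *v u) \<le> ?y \<bullet> (A *v ?y)"
        using False by (intro u) auto
      also have "\<dots> = x \<bullet> (A *v x) / (norm x)\<^sup>2"
        by (simp add: matrix_vector_mult_scaleR power2_eq_square)
      finally show ?thesis
        using False by (simp add: field_simps)
    qed simp
  qed
qed

text \<open>Translates between symmetric matrices and the self-adjoint operators of the fixed point
  argument.\<close>

lemma symmetric_matrix_inner:
  fixes A :: "real^'n^'n"
  shows "symmetric_matrix A \<longleftrightarrow> (\<forall>x y. x \<bullet> (A *v y) = (A *v x) \<bullet> y)"
proof -
  have adj: "x \<bullet> (A *v y) = (transpose A *v x) \<bullet> y" for x y
    by (simp add: dot_lmul_matrix)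
  have "symmetric_matrix A \<longleftrightarrow> (\<forall>x. transpose A *v x = A *v x)"
    unfolding symmetric_matrix_def by (rule matrix_eq)
  also have "\<dots> \<longleftrightarrow> (\<forall>x y. (transpose A *v x) \<bullet> y = (A *v x) \<bullet> y)"
    unfolding vector_eq_rdot ..
  finally show ?thesis by (simp only: adj)
qed

text \<open>For small \<open>t\<close> the matrix \<open>E = 1 - t A\<close> is a contraction, and \<open>Z = (E + Z\<^sup>2) / 2\<close> says that
  \<open>(1 - Z)\<^sup>2 = t A\<close>.\<close>

lemma positive_definite_square_root:
  fixes A :: "real^'n^'n"
  assumes A: "positive_definite A"
  obtains X where "symmetric_matrix X" "X ** X = A"
proof -
  obtain m where m: "0 < m" "\<And>x. m * (norm x)\<^sup>2 \<le> x \<bullet> (A *v x)"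
    using positive_definite_coercive[OF A] by blast
  have symA: "x \<bullet> (A *v y) = (A *v x) \<bullet> y" for x y
    using A by (simp add: positive_definite_def symmetric_matrix_inner)
  obtain K where K: "0 < K" "\<And>x. norm (A *v x) \<le> norm x * K"
    using bounded_linear.pos_bounded[OF matrix_vector_mul_bounded_linear[of A]] by blast
  \<comment> \<open>This value minimises 1 - 2 t m + t^2 K^2, which bounds the squared norm of E = 1
    - t A; the minimum is 1 - m^2 / K^2 < 1.\<close>
  define t where "t = m / K\<^sup>2"
  have t: "0 < t" using m K by (simp add: t_def)
  define e where "e = (\<lambda>x. x - t *\<^sub>R (A *v x))"
  have "bounded_linear e"
    unfolding e_def by (intro bounded_linear_intros matrix_vector_mul_bounded_linear)
  then have E: "blinfun_apply (Blinfun e) = e"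
    by (rule bounded_linear_Blinfun_apply)
  have bound: "(norm (e x))\<^sup>2 \<le> (1 - m\<^sup>2 / K\<^sup>2) * (norm x)\<^sup>2" for x
  proof -
    have "(norm (A *v x))\<^sup>2 \<le> (norm x * K)\<^sup>2"
      by (intro power_mono K) auto
    then have "t\<^sup>2 * (norm (A *v x))\<^sup>2 \<le> t\<^sup>2 * (norm x * K)\<^sup>2"
      by (intro mult_left_mono) auto
    also have "\<dots> = m\<^sup>2 / K\<^sup>2 * (norm x)\<^sup>2"
      using K by (simp add: t_def field_simps power2_eq_square)
    finally have 1: "t\<^sup>2 * (norm (A *v x))\<^sup>2 \<le> m\<^sup>2 / K\<^sup>2 * (norm x)\<^sup>2" .
    have "t * (m * (norm x)\<^sup>2) \<le> t * (x \<bullet> (A *v x))"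
      using t m by (intro mult_left_mono) auto
    then have 2: "m\<^sup>2 / K\<^sup>2 * (norm x)\<^sup>2 \<le> t * (x \<bullet> (A *v x))"
      by (simp add: t_def field_simps power2_eq_square)
    have "(norm (e x))\<^sup>2 = (norm x)\<^sup>2 - 2 * (t * (x \<bullet> (A *v x))) + t\<^sup>2 * (norm (A *v x))\<^sup>2"
      unfolding power2_norm_eq_inner e_def
      by (simp add: inner_diff_left inner_diff_right inner_commute power2_eq_square)
    with 1 2 show ?thesis by (simp add: algebra_simps)
  qed
  \<comment> \<open>Evaluating \<open>bound\<close> at an arbitrary unit vector shows that the
    radicand of \<open>r\<close> is nonnegative.\<close>
  have q0: "0 \<le> 1 - m\<^sup>2 / K\<^sup>2"
    using order_trans[OF zero_le_power2 bound[of "axis undefined 1"]] by simp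
  define r where "r = sqrt (1 - m\<^sup>2 / K\<^sup>2)"
  have "r < 1" using m K by (simp add: r_def)
  moreover have "norm (Blinfun e) \<le> r"
  proof (rule norm_blinfun_bound)
    show "0 \<le> r" using q0 by (simp add: r_def)
    show "norm (blinfun_apply (Blinfun e) x) \<le> r * norm x" for x
      using real_sqrt_le_mono[OF bound[of x]] by (simp add: E r_def real_sqrt_mult)
  qed
  moreover have "x \<bullet> blinfun_apply (Blinfun e) y = blinfun_apply (Blinfun e) x \<bullet> y" for x y
    unfolding E by (simp add: e_def inner_diff_left inner_diff_right symA)
  ultimately obtain Z where Z: "2 *\<^sub>R Z = Blinfun e + (Z o\<^sub>L Z)" "\<And>x y. x \<bullet> Z y = Z x \<bullet> y"
    using fixed_point_selfadjoint by blast
  define X where "X = matrix (\<lambda>x. (1 / sqrt t) *\<^sub>R (x - Z x))"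
  have X: "X *v x = (1 / sqrt t) *\<^sub>R (x - Z x)" for x
  proof -
    have "linear (\<lambda>x. (1 / sqrt t) *\<^sub>R (x - Z x))"
      by (intro bounded_linear.linear bounded_linear_intros blinfun.bounded_linear_right)
    then show ?thesis unfolding X_def by (simp only: matrix_vector_mul)
  qed
  show thesis
  proof
    show "symmetric_matrix X"
      by (simp add: symmetric_matrix_inner X inner_diff_left inner_diff_right Z)
    have "(X ** X) *v x = A *v x" for x
    proof -
      have "2 *\<^sub>R Z x = e x + Z (Z x)"
        using arg_cong[OF Z(1), of "\<lambda>F. blinfun_apply F x"]
        unfolding blinfun.add_left blinfun.scaleR_left E by simp
      then have "x - Z x - Z (x - Z x) = t *\<^sub>R (A *v x)"
        by (simp add: e_def blinfun.diff_right algebra_simps scaleR_2)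
      then show ?thesis
        using t by (simp add: matrix_vector_mul_assoc[symmetric] X blinfun.scaleR_right scaleR_diff_right[symmetric])
    qed
    then show "X ** X = A" by (simp add: matrix_eq)
  qed
qed

lemma positive_definite_left_inverse:
  fixes A :: "real^'n^'n"
  assumes "positive_definite A"
  obtains B where "B ** A = mat 1"
proof -
  have "A *v x = 0 \<longrightarrow> x = 0" for x
    using assms by (metis inner_zero_right less_irrefl positive_definite_def)
  then show thesis
    using that matrix_left_invertible_ker by metis
qed

section \<open>Symplectic matrices\<close>

lemma symplectic_J_mult_vec_eq_0:
  fixes x :: "real^('d::finite + 'd)"
  assumes "symplectic_J *v x = 0"
  shows "x = 0"
proof -
  \<comment> \<open>The inverse of J is -J.\<close>
  have "block_matrix 0 (- mat 1) (mat 1) 0 ** symplectic_J = (mat 1 :: real^('d + 'd)^('d + 'd))"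
    by (simp add: symplectic_J_def block_matrix_mult matrix_minus_mult_right
        matrix_minus_mult_left mat_1_block_matrix)
  then show ?thesis
    by (metis assms matrix_vector_mul_assoc matrix_vector_mul_lid matrix_vector_mult_0_right)
qed

text \<open>If H x = 0, then J x = H^T J H x = 0.\<close>

lemma symplectic_mult_vec_eq_0:
  assumes "symplectic H" "H *v x = 0"
  shows "x = 0"
  using assms unfolding symplectic_def
  by (metis matrix_vector_mul_assoc matrix_vector_mult_0_right symplectic_J_mult_vec_eq_0)

lemma symplectic_mult:
  assumes "symplectic H" "symplectic K"
  shows "symplectic (H ** K)"
proof -
  have "transpose (H ** K) ** symplectic_J ** (H ** K) =
      transpose K ** (transpose H ** symplectic_J ** H) ** K"
    by (simp only: matrix_transpose_mul matrix_mul_assoc)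
  then show ?thesis using assms by (simp add: symplectic_def)
qed

lemma symplectic_unit_upper:
  assumes "symmetric_matrix S"
  shows "symplectic (unit_upper S)"
  using assms
  by (simp add: symplectic_def symplectic_J_def unit_upper_def transpose_block_matrix
      block_matrix_mult symmetric_matrix_def matrix_ring_simps transpose_zero)

lemma symplectic_unit_lower:
  assumes "symmetric_matrix S"
  shows "symplectic (unit_lower S)"
  using assms
  by (simp add: symplectic_def symplectic_J_def unit_lower_def transpose_block_matrix
      block_matrix_mult symmetric_matrix_def matrix_ring_simps transpose_zero)

lemma transpose_unit_upper:
  "symmetric_matrix S \<Longrightarrow> transpose (unit_upper S) = unit_lower S"
  by (simp add: unit_upper_def unit_lower_def transpose_block_matrix symmetric_matrix_def transpose_zero)

lemma transpose_unit_lower: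
  "symmetric_matrix S \<Longrightarrow> transpose (unit_lower S) = unit_upper S"
  by (simp add: unit_upper_def unit_lower_def transpose_block_matrix symmetric_matrix_def transpose_zero)

text \<open>The quadratic form of L L^T at x is the squared norm of L^T x.\<close>

lemma positive_definite_mult_transpose:
  fixes L :: "real^'n^'n"
  assumes "\<And>x. transpose L *v x = 0 \<Longrightarrow> x = 0"
  shows "positive_definite (L ** transpose L)"
  unfolding positive_definite_def
proof (intro conjI allI impI)
  show "symmetric_matrix (L ** transpose L)"
    by (simp add: symmetric_matrix_def matrix_transpose_mul)
  fix x :: "real^'n" assume "x \<noteq> 0"
  have "x \<bullet> ((L ** transpose L) *v x) = (transpose L *v x) \<bullet> (transpose L *v x)"
    by (metis dot_lmul_matrix matrix_vector_mul_assoc transpose_matrix_vector)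
  also have "\<dots> > 0" using assms \<open>x \<noteq> 0\<close> by (metis inner_gt_zero_iff)
  finally show "x \<bullet> ((L ** transpose L) *v x) > 0" .
qed

section \<open>The two inclusions\<close>

lemma L4_squared_subset_SPP: "L4_squared \<subseteq> SPP"
proof
  fix H :: "real^('d::finite + 'd)^('d + 'd)" assume "H \<in> L4_squared"
  then obtain S1 S2 S3 S4 :: "real^'d^'d" and L where
    S: "symmetric_matrix S1" "symmetric_matrix S2" "symmetric_matrix S3" "symmetric_matrix S4"
    and L: "L = unit_lower S4 ** unit_upper S3 ** unit_lower S2 ** unit_upper S1"
    and H: "H = L ** transpose L"
    by (auto simp: L4_squared_def L4_def)
  \<comment> \<open>Transposition reverses the product and exchanges upper with lower factors, so
    \<open>transpose L\<close> is again a product of symplectic matrices.\<close>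
  have "symplectic L" "symplectic (transpose L)"
    using S by (simp_all add: L matrix_transpose_mul transpose_unit_upper transpose_unit_lower
        symplectic_mult symplectic_unit_upper symplectic_unit_lower)
  then show "H \<in> SPP"
    unfolding SPP_def H
    using positive_definite_mult_transpose symplectic_mult symplectic_mult_vec_eq_0 by blast
qed

text \<open>The choice \<open>S\<^sub>3 = 1\<close>, \<open>S\<^sub>2 = X - 1\<close>, \<open>S\<^sub>1 = - X\<inverse>\<close> makes the product of the three
  rightmost factors block lower triangular with diagonal blocks \<open>X\<close> and \<open>X\<inverse>\<close>; then \<open>X\<^sup>2 = A\<close>
  matches the upper left block of \<open>H\<close>, and \<open>S\<^sub>4\<close> is solved for from the lower left one.\<close>

lemma SPP_subset_L4_squared: "SPP \<subseteq> L4_squared"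
proof
  fix H :: "real^('d::finite + 'd)^('d + 'd)" assume "H \<in> SPP"
  then have pd: "positive_definite H" and sp: "symplectic H" by (auto simp: SPP_def)
  obtain A B C D where H: "H = block_matrix A B C D" by (rule block_matrix_cases)
  have tA: "transpose A = A" and tD: "transpose D = D" and tB: "transpose B = C"
    and tC: "transpose C = B"
    using pd by (auto simp: positive_definite_def H symmetric_matrix_def
        transpose_block_matrix block_matrix_eq_iff)
  have "positive_definite A"
    using pd H positive_definite_block_upper_left by metis
  then obtain X where X: "transpose X = X" "X ** X = A"
    using positive_definite_square_root unfolding symmetric_matrix_def by metis
  obtain A' where "A' ** A = mat 1"
    using positive_definite_left_inverse[OF \<open>positive_definite A\<close>] by blast
  \<comment> \<open>A^-1 X is the inverse of X, because X^2 = A.\<close>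
  define Y where "Y = A' ** X"
  have YX: "Y ** X = mat 1"
    unfolding Y_def by (simp add: matrix_mul_assoc[symmetric] X \<open>A' ** A = mat 1\<close>)
  then have XY: "X ** Y = mat 1" by (simp add: matrix_left_right_inverse)
  have tY: "transpose Y = Y"
  proof -
    have "transpose Y ** X = mat 1"
      by (metis X(1) XY matrix_transpose_mul transpose_mat)
    then show ?thesis by (metis XY matrix_mul_assoc matrix_mul_lid matrix_mul_rid)
  qed
  \<comment> \<open>Cancellation rules for products that have been associated to the right.\<close>
  have XYZ: "X ** (Y ** Z) = Z" "Y ** (X ** Z) = Z" for Z :: "real^'d^'d"
    by (simp_all add: matrix_mul_assoc XY YX)
  \<comment> \<open>As H is symmetric, symplecticity reads H J H = J; these are its two upper
    blocks.\<close>
  have JH: "A ** C = B ** A" "A ** D = mat 1 + B ** B"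
  proof -
    have "block_matrix A B C D ** symplectic_J ** block_matrix A B C D = symplectic_J"
      using sp by (simp add: symplectic_def H transpose_block_matrix tA tB tC tD)
    then show "A ** C = B ** A" "A ** D = mat 1 + B ** B"
      by (auto simp: symplectic_J_def block_matrix_mult block_matrix_eq_iff matrix_ring_simps
          algebra_simps)
  qed
  \<comment> \<open>T is C A^-1. Multiplying A C = B A by A^-1 on both sides gives T = A^-1 B, which
    is the transpose of C A^-1; hence T is symmetric.\<close>
  define T where "T = C ** (Y ** Y)"
  have T: "T = Y ** (Y ** B)"
  proof -
    have "Y ** (Y ** (A ** C ** (Y ** Y))) = Y ** (Y ** (B ** A ** (Y ** Y)))"
      by (simp add: JH)
    then show ?thesis
      by (simp add: T_def X(2)[symmetric] matrix_mul_assoc[symmetric] XYZ XY)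
  qed
  have tT: "transpose T = T"
    using T by (simp add: T_def matrix_transpose_mul tY tB tC matrix_mul_assoc)
  have TA: "T ** X ** X = C"
    by (simp add: T_def matrix_mul_assoc[symmetric] XYZ YX)
  \<comment> \<open>Multiply A D = 1 + B^2 on the left by A^-1 = Y^2 and use T = Y^2 B.\<close>
  have D: "D = T ** B + Y ** Y"
  proof -
    have "Y ** (Y ** (A ** D)) = Y ** (Y ** (mat 1 + B ** B))" by (simp add: JH)
    then show ?thesis
      by (simp add: T X(2)[symmetric] matrix_mul_assoc[symmetric] XYZ matrix_ring_simps add.commute)
  qed
  \<comment> \<open>The lower left block of the four-factor product is S4 X + X - 1; equating it to
    T X gives this value.\<close>
  define S4 where "S4 = T - mat 1 + Y"
  define L where "L = unit_lower S4 ** unit_upper (mat 1) ** unit_lower (X - mat 1) ** unit_upper (- Y)"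
  have L: "L = block_matrix X 0 (T ** X) Y"
    unfolding L_def unit_lower_def unit_upper_def block_matrix_mult block_matrix_eq_iff
    by (simp add: matrix_ring_simps S4_def XY YX matrix_mul_assoc[symmetric] algebra_simps)
  have "L \<in> L4"
    unfolding L4_def L_def
    by (fastforce simp: symmetric_matrix_def S4_def transpose_diff transpose_add transpose_uminus tT tY X)
  moreover have "H = L ** transpose L"
  proof -
    \<comment> \<open>Transpose of T X^2 = C; it yields the upper right block of L L^T and, after
      multiplication by T, the term T B of the lower right one.\<close>
    have "X ** transpose (T ** X) = B"
      using TA by (metis X(1) matrix_mul_assoc matrix_transpose_mul tC)
    moreover have "T ** X ** transpose (T ** X) = T ** B"
      using calculation by (metis matrix_mul_assoc)
    ultimately show ?thesis
      unfolding H L transpose_block_matrix block_matrix_mult block_matrix_eq_iff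
      by (simp add: X tY TA D transpose_zero)
  qed
  ultimately show "H \<in> L4_squared" by (auto simp: L4_squared_def)
qed

theorem theorem14:
  shows "(SPP :: (real^('d::finite + 'd)^('d + 'd)) set) = L4_squared \<and>
    (\<forall>H :: real^('d + 'd)^('d + 'd). positive_definite H \<and> symplectic H \<longrightarrow>
       (\<exists>Ms L. length Ms \<le> 4 \<and> set Ms \<subseteq> unit_triangular_symplectic \<and>
          L = foldr (**) Ms (mat 1) \<and> H = L ** transpose L))"
proof (intro conjI allI impI)
  show eq: "(SPP :: (real^('d + 'd)^('d + 'd)) set) = L4_squared"
    using L4_squared_subset_SPP SPP_subset_L4_squared by blast
  fix H :: "real^('d + 'd)^('d + 'd)"
  assume "positive_definite H \<and> symplectic H"
  then have "H \<in> L4_squared" by (simp add: eq[symmetric] SPP_def)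
  then obtain S1 S2 S3 S4 :: "real^'d^'d" and L where
    S: "symmetric_matrix S1" "symmetric_matrix S2" "symmetric_matrix S3" "symmetric_matrix S4"
    and L: "L = unit_lower S4 ** unit_upper S3 ** unit_lower S2 ** unit_upper S1"
    and H: "H = L ** transpose L"
    by (auto simp: L4_squared_def L4_def)
  let ?Ms = "[unit_lower S4, unit_upper S3, unit_lower S2, unit_upper S1]"
  have "set ?Ms \<subseteq> unit_triangular_symplectic"
    using S by (auto simp: unit_triangular_symplectic_def)
  \<comment> \<open>\<open>foldr\<close> associates to the right and ends in \<open>mat 1\<close>,
    whereas \<open>L4\<close> associates to the left.\<close>
  moreover have "L = foldr (**) ?Ms (mat 1)"
    by (simp add: L matrix_mul_assoc)
  ultimately show "\<exists>Ms L. length Ms \<le> 4 \<and> set Ms \<subseteq> unit_triangular_symplectic \<and>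
      L = foldr (**) Ms (mat 1) \<and> H = L ** transpose L"
    using H by (intro exI[of _ ?Ms] exI[of _ L]) simp
qed

end
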